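(* For all integers $N\geq 1$, \[N D_N(\omega)=N^R D_{N^R}(\omega).\]
   Context: Every nonnegative integer $n$ has a unique binary expansion $n=\sum_{i=0}^{\nu}\varepsilon_i(n)2^i$ with $\varepsilon_i(n)\in\{0,1\}$ and ($\nu=0$ or $\varepsilon_\nu(n)\neq 0$). The digit reversal of $n$ is $n^R=\sum_{0\leq i\leq\nu}\varepsilon_{\nu-i}(n)2^i$. The Van der Corput sequence in base $2$ is $\omega=(\omega_n)_{n\geq 0}$ with $\omega_n=\sum_{i=0}^{\nu}\varepsilon_i(n)2^{-i-1}$. For a sequence $x=(x_n)_{n\geq 0}$ in $[0,1)$ and an integer $N\geq 1$, the discrepancy is $D_N(x)=\sup_{0\leq a\leq b\leq 1}\left|\frac{A_N(x,a,b)}{N}-(b-a)\right|$, where $A_N(x,a,b)=|\{0\leq n<N: a\leq x_n<b\}|$. *)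

theory Defs
  imports "HOL-Analysis.Analysis" "HOL-Library.Discrete_Functions"
begin

definition bin_digit :: "nat \<Rightarrow> nat \<Rightarrow> nat" where
  "bin_digit n i = (n div 2 ^ i) mod 2"

text \<open>
  Index of the leading binary digit; the library function \<^const>\<open>floor_log\<close> is the floor of the
  base-2 logarithm and takes the value 0 at 0.  The lemmas below establish that
  \<^const>\<open>bin_digit\<close> and this index are exactly the data of the unique binary expansion.
\<close>
definition bin_top :: "nat \<Rightarrow> nat" where
  "bin_top n = floor_log n"

definition digit_reversal :: "nat \<Rightarrow> nat" where
  "digit_reversal n = (\<Sum>i = 0..bin_top n. bin_digit n (bin_top n - i) * 2 ^ i)"

definition van_der_corput :: "nat \<Rightarrow> real" where
  "van_der_corput n = (\<Sum>i = 0..bin_top n. real (bin_digit n i) / 2 ^ (i + 1))"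

definition interval_count :: "nat \<Rightarrow> (nat \<Rightarrow> real) \<Rightarrow> real \<Rightarrow> real \<Rightarrow> nat" where
  "interval_count N x a b = card {n. n < N \<and> a \<le> x n \<and> x n < b}"

definition discrepancy :: "nat \<Rightarrow> (nat \<Rightarrow> real) \<Rightarrow> real" where
  "discrepancy N x =
     (SUP (a, b) \<in> {(a, b). 0 \<le> a \<and> a \<le> b \<and> b \<le> 1}.
        \<bar>real (interval_count N x a b) / real N - (b - a)\<bar>)"

lemma bin_digit_01: "bin_digit n i \<in> {0, 1}"
  by (auto simp: bin_digit_def)

lemma binary_expansion_aux: "(\<Sum>i<k. bin_digit n i * 2 ^ i) = n mod 2 ^ k"
proof (induction k)
  case (Suc k)
  have "n mod (2 ^ k * 2) = 2 ^ k * (n div 2 ^ k mod 2) + n mod 2 ^ k"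
    by (rule mod_mult2_eq)
  with Suc show ?case by (simp add: bin_digit_def mult.commute)
qed simp

lemma less_power_bin_top: "n < 2 ^ Suc (bin_top n)"
  using floor_log_exp2_gt[of n] by (cases "n = 0") (simp_all add: bin_top_def)

lemma binary_expansion: "n = (\<Sum>i = 0..bin_top n. bin_digit n i * 2 ^ i)"
  using binary_expansion_aux[of n "Suc (bin_top n)"] less_power_bin_top[of n]
  by (simp only: atLeast0AtMost lessThan_Suc_atMost mod_less)

lemma bin_top_leading: "bin_top n = 0 \<or> bin_digit n (bin_top n) \<noteq> 0"
proof (cases "n = 0")
  case False
  then have "2 ^ bin_top n \<le> n" by (simp add: bin_top_def floor_log_exp2_le)
  moreover have "n < 2 * 2 ^ bin_top n" using less_power_bin_top[of n] by simp
  ultimately have "n div 2 ^ bin_top n = 1" by (intro div_nat_eqI) simp_all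
  then show ?thesis by (simp add: bin_digit_def)
qed (simp add: bin_top_def)

lemma binary_sum_less:
  fixes e :: "nat \<Rightarrow> nat"
  assumes "\<And>i. i < k \<Longrightarrow> e i \<in> {0, 1}"
  shows "(\<Sum>i<k. e i * 2 ^ i) < 2 ^ k"
  using assms
proof (induction k)
  case (Suc k)
  then have "(\<Sum>i<k. e i * 2 ^ i) < 2 ^ k" "e k \<in> {0, 1}" by simp_all
  then show ?case by auto
qed simp

lemma binary_sum_digit:
  fixes e :: "nat \<Rightarrow> nat"
  assumes "\<And>i. i < k \<Longrightarrow> e i \<in> {0, 1}" and "j < k"
  shows "bin_digit (\<Sum>i<k. e i * 2 ^ i) j = e j"
  using assms
proof (induction k)
  case (Suc k)
  let ?s = "\<Sum>i<k. e i * 2 ^ i"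
  have s: "?s < 2 ^ k" using Suc.prems by (intro binary_sum_less) simp
  have ek: "e k \<in> {0, 1}" using Suc.prems by simp
  show ?case
  proof (cases "j = k")
    case True
    have "(e k * 2 ^ k + ?s) div 2 ^ k = e k" using s by simp
    then show ?thesis using True ek by (auto simp: bin_digit_def add.commute)
  next
    case False
    then have j: "j < k" using Suc.prems by simp
    define d where "d = k - Suc j"
    have k: "k = j + Suc d" using j by (simp add: d_def)
    have "(2 ^ j * (2 * (e k * 2 ^ d)) + ?s) div 2 ^ j = 2 * (e k * 2 ^ d) + ?s div 2 ^ j"
      by simp
    moreover have "e k * 2 ^ k = 2 ^ j * (2 * (e k * 2 ^ d))"
      by (simp add: k power_add)
    ultimately have "(?s + e k * 2 ^ k) div 2 ^ j = 2 * (e k * 2 ^ d) + ?s div 2 ^ j"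
      by (simp only: add.commute)
    then have "bin_digit (?s + e k * 2 ^ k) j = bin_digit ?s j"
      unfolding bin_digit_def by (simp only: mod_mult_self4)
    then show ?thesis using Suc.IH Suc.prems j by simp
  qed
qed simp

lemma binary_expansion_unique:
  fixes e :: "nat \<Rightarrow> nat"
  assumes n: "n = (\<Sum>i = 0..m. e i * 2 ^ i)"
    and e: "\<And>i. i \<le> m \<Longrightarrow> e i \<in> {0, 1}"
    and m: "m = 0 \<or> e m \<noteq> 0"
  shows "m = bin_top n" and "\<And>i. i \<le> m \<Longrightarrow> e i = bin_digit n i"
proof -
  have n': "n = (\<Sum>i<Suc m. e i * 2 ^ i)"
    using n by (simp only: atLeast0AtMost lessThan_Suc_atMost)
  show "\<And>i. i \<le> m \<Longrightarrow> e i = bin_digit n i"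
    unfolding n' using e by (subst binary_sum_digit) auto
  have up: "n < 2 ^ Suc m"
    unfolding n' using e by (intro binary_sum_less) auto
  show "m = bin_top n"
  proof (cases "m = 0")
    case True
    then have "n = 0 \<or> n = 1" using up by auto
    then show ?thesis using True by (auto simp: bin_top_def)
  next
    case False
    then have "e m = 1" using m e[of m] by auto
    then have "2 ^ m \<le> n" unfolding n' by simp
    then have "floor_log n = m" using up by (intro floor_log_eqI) simp_all
    then show ?thesis by (simp add: bin_top_def)
  qed
qed

lemma van_der_corput_range: "van_der_corput n \<in> {0..<1}"
proof -
  have "(\<Sum>i<k. real (bin_digit n i) / 2 ^ (i + 1)) \<le> 1 - 1 / 2 ^ k" for k
  proof (induction k)
    case (Suc k)
    have "real (bin_digit n k) / 2 ^ (k + 1) \<le> 1 / 2 ^ (k + 1)"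
      using bin_digit_01[of n k] by (intro divide_right_mono) auto
    with Suc show ?case by simp
  qed simp
  from this[of "Suc (bin_top n)"]
  have "van_der_corput n \<le> 1 - 1 / 2 ^ Suc (bin_top n)"
    unfolding van_der_corput_def by (simp only: atLeast0AtMost lessThan_Suc_atMost)
  also have "\<dots> < 1" by simp
  finally have "van_der_corput n < 1" .
  moreover have "0 \<le> van_der_corput n"
    unfolding van_der_corput_def by (intro sum_nonneg) simp
  ultimately show ?thesis by simp
qed

text \<open>
  The supremum defining the discrepancy is over a nonempty bounded set, so it is the genuine one.
\<close>
lemma discrepancy_bdd_above:
  "bdd_above ((\<lambda>(a, b). \<bar>real (interval_count N x a b) / real N - (b - a)\<bar>) `
     {(a, b). 0 \<le> a \<and> a \<le> b \<and> b \<le> 1})"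
proof -
  have *: "0 \<le> real (interval_count N x a b) / real N"
          "real (interval_count N x a b) / real N \<le> 1" for a b
  proof -
    have "interval_count N x a b \<le> card {..<N}"
      unfolding interval_count_def by (intro card_mono) auto
    then show "real (interval_count N x a b) / real N \<le> 1"
      by (cases "N = 0") simp_all
  qed simp
  show ?thesis
  proof (rule bdd_aboveI2[where M = 1], clarify)
    fix a b :: real
    assume "0 \<le> a" "a \<le> b" "b \<le> 1"
    then show "\<bar>real (interval_count N x a b) / real N - (b - a)\<bar> \<le> 1"
      using *[of a b] by linarith
  qed
qed

lemma discrepancy_index_nonempty: "{(a, b). 0 \<le> a \<and> a \<le> b \<and> b \<le> (1 :: real)} \<noteq> {}"
  by force

end

theory Submission
  imports Defs
begin

text \<open>
  Write \<open>\<Delta> N t\<close> for the number of \<open>n < N\<close> with \<open>\<omega> n < t\<close>, minus \<open>N t\<close>, and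
  \<open>d N = (\<Sum>n<N. 1 - 2 \<omega> n)\<close>.  The self-similarity \<open>\<omega> (2 n) = \<omega> n / 2\<close>,
  \<open>\<omega> (2 n + 1) = (1 + \<omega> n) / 2\<close> gives recursions for \<open>\<Delta>\<close> that yield \<open>0 \<le> \<Delta> N t \<le> d N\<close>;
  the upper bound is sharp because \<open>\<Delta> n\<close> and \<open>\<Delta> (n + 1)\<close> have common approximate maximisers.
  Hence \<open>N D\<^sub>N = d N\<close>.  Finally \<open>d (2 n) = d n\<close> and \<open>d (2 n + 1) = d n + 1 - \<omega> n\<close>, while for
  \<open>n < 2 ^ k\<close> one has \<open>d (2 ^ k + n) = d n + 1 - n / 2 ^ k\<close>; as \<open>\<omega> n\<close> is \<open>n\<^sup>R\<close> scaled by a power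
  of two, adding a lowest digit to \<open>n\<close> changes \<open>d\<close> exactly as adding it as a highest digit to
  \<open>n\<^sup>R\<close> does.
\<close>

section \<open>Self-similarity of the Van der Corput sequence\<close>

lemma bin_digit_double [simp]:
  "bin_digit (2 * n) 0 = 0" "bin_digit (Suc (2 * n)) 0 = 1"
  "bin_digit (2 * n) (Suc i) = bin_digit n i" "bin_digit (Suc (2 * n)) (Suc i) = bin_digit n i"
  by (simp_all add: bin_digit_def div_mult2_eq)

text \<open>Digits above the leading one vanish, so the sum may run to any sufficient length. The
  halving rules then follow by shifting digits, without tracking \<open>bin_top\<close>.\<close>

lemma van_der_corput_eq_sum:
  assumes "n < 2 ^ k"
  shows "van_der_corput n = (\<Sum>i<k. real (bin_digit n i) / 2 ^ (i + 1))"
proof (cases "n = 0")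
  case True
  then show ?thesis by (simp add: van_der_corput_def bin_digit_def)
next
  case False
  then have "2 ^ bin_top n \<le> n" by (simp add: bin_top_def floor_log_exp2_le)
  with assms have "(2::nat) ^ bin_top n < 2 ^ k" by linarith
  then have k: "Suc (bin_top n) \<le> k" by simp
  have "bin_digit n i = 0" if "Suc (bin_top n) \<le> i" for i
  proof -
    have "n < 2 ^ i"
      using less_power_bin_top[of n] power_increasing[OF that, of "2::nat"] by linarith
    then show ?thesis by (simp add: bin_digit_def)
  qed
  then have "(\<Sum>i<Suc (bin_top n). real (bin_digit n i) / 2 ^ (i + 1)) =
      (\<Sum>i<k. real (bin_digit n i) / 2 ^ (i + 1))"
    using k by (intro sum.mono_neutral_left) auto
  then show ?thesis
    unfolding van_der_corput_def by (simp only: atLeast0AtMost lessThan_Suc_atMost)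
qed

lemma van_der_corput_even [simp]: "van_der_corput (2 * n) = van_der_corput n / 2"
proof -
  have n: "n < 2 ^ n" by simp
  then have "2 * n < 2 ^ Suc n" by simp
  from van_der_corput_eq_sum[OF this] van_der_corput_eq_sum[OF n] show ?thesis
    by (simp only: sum.lessThan_Suc_shift bin_digit_double) (simp add: sum_divide_distrib ac_simps)
qed

lemma van_der_corput_odd [simp]: "van_der_corput (Suc (2 * n)) = (1 + van_der_corput n) / 2"
proof -
  have n: "n < 2 ^ n" by simp
  then have "Suc (2 * n) < 2 ^ Suc n" unfolding power_Suc by linarith
  from van_der_corput_eq_sum[OF this] van_der_corput_eq_sum[OF n] show ?thesis
    by (simp only: sum.lessThan_Suc_shift bin_digit_double)
      (simp add: sum_divide_distrib add_divide_distrib ac_simps)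
qed

lemma van_der_corput_0 [simp]: "van_der_corput 0 = 0"
  by (simp add: van_der_corput_def bin_digit_def)

lemma van_der_corput_bounds: "0 \<le> van_der_corput n" "van_der_corput n < 1"
  using van_der_corput_range[of n] by auto

lemma van_der_corput_power_add:
  assumes "n < 2 ^ k"
  shows "van_der_corput (2 ^ k + n) = van_der_corput n + 1 / 2 ^ Suc k"
  using assms
proof (induction k arbitrary: n)
  case 0
  then show ?case using van_der_corput_odd[of 0] by simp
next
  case (Suc k)
  obtain m where "n = 2 * m \<or> n = Suc (2 * m)" by (metis evenE oddE Suc_eq_plus1)
  then show ?case
  proof
    assume n: "n = 2 * m"
    with Suc.prems have "m < 2 ^ k" by simp
    then show ?thesis
      using n Suc.IH[of m] van_der_corput_even[of "2 ^ k + m"] by (simp add: add_divide_distrib)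
  next
    assume n: "n = Suc (2 * m)"
    with Suc.prems have "m < 2 ^ k" by simp
    then show ?thesis
      using n Suc.IH[of m] van_der_corput_odd[of "2 ^ k + m"] by (simp add: add_divide_distrib)
  qed
qed

section \<open>Counting excess and its recursions\<close>

definition count_excess :: "nat \<Rightarrow> real \<Rightarrow> real" where
  "count_excess N t = (\<Sum>n<N. of_bool (van_der_corput n < t) - t)"

text \<open>\<open>count_excess\<close> and \<open>max_excess\<close> are \<Delta> and
  \<open>d\<close> above. The latter is a supremum: for \<open>N = 1\<close> it is approached as
  \<open>t\<close> decreases to 0, but not attained.\<close>

definition max_excess :: "nat \<Rightarrow> real" where
  "max_excess N = (\<Sum>n<N. 1 - 2 * van_der_corput n)"

lemma count_excess_0 [simp]: "count_excess 0 t = 0"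
  and count_excess_Suc:
    "count_excess (Suc N) t = count_excess N t + of_bool (van_der_corput N < t) - t"
  by (simp_all add: count_excess_def)

lemma max_excess_0 [simp]: "max_excess 0 = 0"
  and max_excess_Suc: "max_excess (Suc N) = max_excess N + 1 - 2 * van_der_corput N"
  by (simp_all add: max_excess_def)

text \<open>Odd indices land in the right half and are never counted; each pair of terms subtracts
  \<open>s / 2\<close> twice.\<close>

lemma count_excess_even_left:
  assumes "s \<le> 1"
  shows "count_excess (2 * n) (s / 2) = count_excess n s"
proof (induction n)
  case (Suc n)
  have "\<not> (1 + van_der_corput n) / 2 < s / 2"
    using assms van_der_corput_bounds[of n] by simp
  with Suc show ?case by (simp add: count_excess_Suc)
qed simp

lemma count_excess_even_right:
  assumes "0 \<le> s"
  shows "count_excess (2 * n) ((1 + s) / 2) = count_excess n s"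
proof (induction n)
  case (Suc n)
  have "van_der_corput n / 2 < (1 + s) / 2"
    using assms van_der_corput_bounds[of n] by simp
  with Suc show ?case by (simp add: count_excess_Suc)
qed simp

lemma count_excess_odd_left:
  assumes "s \<le> 1"
  shows "count_excess (Suc (2 * n)) (s / 2) =
    count_excess n s + of_bool (van_der_corput n < s) - s / 2"
  using assms by (simp add: count_excess_Suc count_excess_even_left)

lemma count_excess_odd_right:
  assumes "0 \<le> s"
  shows "count_excess (Suc (2 * n)) ((1 + s) / 2) = count_excess n s + (1 - s) / 2"
proof -
  have "van_der_corput n / 2 < (1 + s) / 2"
    using assms van_der_corput_bounds[of n] by simp
  then show ?thesis
    using assms count_excess_even_right[of s n]
    by (simp add: count_excess_Suc add_divide_distrib diff_divide_distrib)
qed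

lemma max_excess_even [simp]: "max_excess (2 * n) = max_excess n"
  by (induction n) (simp_all add: max_excess_Suc add_divide_distrib)

lemma max_excess_odd [simp]: "max_excess (Suc (2 * n)) = max_excess n + 1 - van_der_corput n"
  by (simp add: max_excess_Suc)

lemma max_excess_double_add_2 [simp]: "max_excess (Suc (Suc (2 * n))) = max_excess (Suc n)"
  using max_excess_even[of "Suc n"] by simp

section \<open>Sharp bounds for the excess\<close>

lemma half_interval_cases:
  assumes "t \<in> {0..1::real}"
  obtains s where "s \<in> {0..1}" "t = s / 2" | s where "s \<in> {0..1}" "t = (1 + s) / 2"
proof (cases "t \<le> 1 / 2")
  case True
  then show thesis using assms by (intro that(1)[of "2 * t"]) auto
next
  case False
  then show thesis using assms by (intro that(2)[of "2 * t - 1"]) auto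
qed

text \<open>At \<open>2 * n + 1\<close> the excess is the average of those for \<open>n\<close> and
  \<open>n + 1\<close> at \<open>s\<close>, plus 0 or 1/2; \<open>max_excess\<close> is the
  corresponding average plus exactly 1/2.\<close>

lemma count_excess_bounds:
  assumes "t \<in> {0..1}"
  shows "0 \<le> count_excess N t \<and> count_excess N t \<le> max_excess N"
  using assms
proof (induction N arbitrary: t rule: less_induct)
  case (less N)
  obtain n where "N = 2 * n \<or> N = Suc (2 * n)" by (metis evenE oddE Suc_eq_plus1)
  \<comment> \<open>\<open>N = 1\<close> stands apart because there \<open>n + 1 = N\<close>, out of
    reach of the induction hypothesis.\<close>
  then consider "N = 0" | "N = 1" | "N = 2 * n" "0 < n" | "N = Suc (2 * n)" "0 < n"
    by (cases n) auto
  then show ?case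
  proof cases
    case 1
    then show ?thesis by simp
  next
    case 2
    then show ?thesis using less.prems by (simp add: count_excess_Suc max_excess_Suc)
  next
    case 3
    then have "n < N" by simp
    from less.prems show ?thesis
    proof (cases rule: half_interval_cases)
      case (1 s)
      then show ?thesis
        unfolding 3(1) 1(2) using less.IH[OF \<open>n < N\<close> 1(1)] by (simp add: count_excess_even_left)
    next
      case (2 s)
      then show ?thesis
        unfolding 3(1) 2(2) using less.IH[OF \<open>n < N\<close> 2(1)] by (simp add: count_excess_even_right)
    qed
  next
    case 4
    then have lt: "n < N" "Suc n < N" by auto
    from less.prems show ?thesis
    proof (cases rule: half_interval_cases)
      case (1 s)
      show ?thesis
        unfolding 4(1) 1(2)
        using less.IH[OF lt(1) 1(1)] less.IH[OF lt(2) 1(1)] 1(1) van_der_corput_bounds[of n]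
        by (cases "van_der_corput n < s")
          (auto simp: count_excess_odd_left count_excess_Suc[of n] max_excess_Suc[of n])
    next
      case (2 s)
      show ?thesis
        unfolding 4(1) 2(2)
        using less.IH[OF lt(1) 2(1)] less.IH[OF lt(2) 2(1)] 2(1) van_der_corput_bounds[of n]
        by (cases "van_der_corput n < s")
          (auto simp: count_excess_odd_right count_excess_Suc[of n] max_excess_Suc[of n] diff_divide_distrib)
    qed
  qed
qed

text \<open>
  Averaging the two lower bounds for \<open>n\<close> and \<open>n + 1\<close> at a common point gives the one for
  \<open>2 n + 1\<close>, which is why both are carried through the induction.
\<close>
lemma common_maximizer:
  assumes "0 < e"
  shows "\<exists>s\<in>{0..1}. max_excess n - e \<le> count_excess n s \<and>
    max_excess (Suc n) - e \<le> count_excess (Suc n) s"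
proof (induction n rule: less_induct)
  case (less n)
  \<comment> \<open>One point serves three consecutive indices, which covers both parities of
    \<open>n\<close>.\<close>
  have step: "\<exists>t\<in>{0..1}. max_excess (2 * m) - e \<le> count_excess (2 * m) t \<and>
      max_excess (Suc (2 * m)) - e \<le> count_excess (Suc (2 * m)) t \<and>
      max_excess (Suc (Suc (2 * m))) - e \<le> count_excess (Suc (Suc (2 * m))) t"
    if m: "m < n" for m
  proof -
    obtain s where s: "s \<in> {0..1}" "max_excess m - e \<le> count_excess m s"
        "max_excess (Suc m) - e \<le> count_excess (Suc m) s"
      using less.IH[OF m] by auto
    \<comment> \<open>This choice of half gains the full 1/2 over the average at
      \<open>2 * m + 1\<close>.\<close>
    define t where "t = (if van_der_corput m < s then s / 2 else (1 + s) / 2)"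
    have "t \<in> {0..1}" using s(1) by (auto simp: t_def)
    moreover have "count_excess (2 * m) t = count_excess m s"
        "count_excess (Suc (Suc (2 * m))) t = count_excess (Suc m) s"
      using s(1) count_excess_even_left[of s "Suc m"] count_excess_even_right[of s "Suc m"]
      by (auto simp: t_def count_excess_even_left count_excess_even_right)
    moreover have "max_excess (Suc (2 * m)) - e \<le> count_excess (Suc (2 * m)) t"
      using s by (auto simp: t_def count_excess_odd_left count_excess_odd_right
          count_excess_Suc[of m] max_excess_Suc[of m] diff_divide_distrib)
    ultimately show ?thesis using s by (intro bexI[of _ t]) simp_all
  qed
  obtain m where "n = 2 * m \<or> n = Suc (2 * m)" by (metis evenE oddE Suc_eq_plus1)
  then consider "n = 0" | "n = 2 * m" "m < n" | "n = Suc (2 * m)" "m < n" by (cases m) auto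
  then show ?case
  proof cases
    case 1
    then show ?thesis
      \<comment> \<open>The point must be positive to count \<omega>(0) = 0, and at most
        \<open>e\<close> to lose no more than \<open>e\<close>.\<close>
      using assms by (intro bexI[of _ "min e 1"]) (auto simp: count_excess_Suc max_excess_Suc)
  qed (use step in blast)+
qed

section \<open>From the excess to the discrepancy\<close>

lemma interval_count_eq_count_excess:
  assumes "a \<le> b"
  shows "real (interval_count N van_der_corput a b) - real N * (b - a) =
    count_excess N b - count_excess N a"
proof -
  have "real (interval_count N van_der_corput a b) =
      (\<Sum>n<N. of_bool (a \<le> van_der_corput n \<and> van_der_corput n < b))"
    by (simp add: interval_count_def Int_def lessThan_def)
  also have "\<dots> = (\<Sum>n<N. of_bool (van_der_corput n < b) - of_bool (van_der_corput n < a))"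
    using assms by (intro sum.cong) auto
  finally show ?thesis
    by (simp add: count_excess_def sum_subtractf right_diff_distrib)
qed

lemma discrepancy_van_der_corput:
  assumes "0 < N"
  shows "real N * discrepancy N van_der_corput = max_excess N"
proof (rule antisym)
  let ?I = "{(a, b). 0 \<le> a \<and> a \<le> b \<and> b \<le> (1::real)}"
  let ?f = "\<lambda>(a, b). \<bar>real (interval_count N van_der_corput a b) / real N - (b - a)\<bar>"
  have f: "?f (a, b) = \<bar>count_excess N b - count_excess N a\<bar> / real N" if "a \<le> b" for a b
  proof -
    have "real (interval_count N van_der_corput a b) / real N - (b - a) =
        (count_excess N b - count_excess N a) / real N"
      using assms interval_count_eq_count_excess[OF that, of N] by (simp add: field_simps)
    then show ?thesis by simp
  qed
  have "discrepancy N van_der_corput \<le> max_excess N / real N"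
    unfolding discrepancy_def
  proof (rule cSUP_least[OF discrepancy_index_nonempty])
    fix p assume "p \<in> ?I"
    then obtain a b where p: "p = (a, b)" "0 \<le> a" "a \<le> b" "b \<le> 1" by auto
    \<comment> \<open>Both values lie between 0 and \<open>max_excess N\<close>, hence so does their
      distance.\<close>
    have "\<bar>count_excess N b - count_excess N a\<bar> \<le> max_excess N"
      using count_excess_bounds[of a N] count_excess_bounds[of b N] p by auto
    then show "?f p \<le> max_excess N / real N"
      unfolding p(1) f[OF p(3)] by (intro divide_right_mono) auto
  qed
  then show "real N * discrepancy N van_der_corput \<le> max_excess N"
    using assms by (simp add: field_simps)
  show "max_excess N \<le> real N * discrepancy N van_der_corput"
  proof (rule field_le_epsilon)
    fix e :: real assume "0 < e"
    then obtain s where s: "s \<in> {0..1}" "max_excess N - e \<le> count_excess N s"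
      using common_maximizer by blast
    \<comment> \<open>Intervals starting at 0 already come within \<open>e\<close>, since the excess
      at 0 vanishes.\<close>
    have "?f (0, s) \<le> discrepancy N van_der_corput"
      unfolding discrepancy_def using s(1) by (intro cSUP_upper discrepancy_bdd_above) auto
    moreover have "count_excess N 0 = 0"
      unfolding count_excess_def
      using van_der_corput_bounds by (intro sum.neutral) (simp add: not_less)
    ultimately have "count_excess N s \<le> real N * discrepancy N van_der_corput"
      using s(1) f[of 0 s] assms by (simp add: field_simps)
    with s(2) show "max_excess N \<le> real N * discrepancy N van_der_corput + e" by linarith
  qed
qed

section \<open>Recursions for digit reversal\<close>

text \<open>The scaling turns the weight \<open>1 / 2 ^ (i + 1)\<close> of digit \<open>i\<close>
  into \<open>2 ^ (bin_top n - i)\<close>, its weight in the reversal.\<close>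

lemma digit_reversal_eq_van_der_corput:
  "real (digit_reversal n) = 2 ^ Suc (bin_top n) * van_der_corput n"
proof -
  let ?t = "bin_top n"
  have "real (digit_reversal n) = (\<Sum>i\<le>?t. real (bin_digit n (?t - i)) * 2 ^ i)"
    by (simp add: digit_reversal_def atLeast0AtMost)
  also have "\<dots> = (\<Sum>i\<le>?t. real (bin_digit n i) * 2 ^ (?t - i))"
    by (rule sum.reindex_bij_witness[of _ "\<lambda>i. ?t - i" "\<lambda>i. ?t - i"]) auto
  also have "\<dots> = (\<Sum>i\<le>?t. 2 ^ Suc ?t * (real (bin_digit n i) / 2 ^ (i + 1)))"
    by (intro sum.cong) (auto simp: power_diff)
  finally show ?thesis
    by (simp add: van_der_corput_def atLeast0AtMost sum_distrib_left)
qed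

lemma bin_top_double [simp]:
  assumes "0 < n"
  shows "bin_top (2 * n) = Suc (bin_top n)" "bin_top (Suc (2 * n)) = Suc (bin_top n)"
proof -
  show "bin_top (2 * n) = Suc (bin_top n)"
    using assms by (simp add: bin_top_def floor_log_twice)
  show "bin_top (Suc (2 * n)) = Suc (bin_top n)"
    using assms floor_log_rec[of "Suc (2 * n)"] by (simp add: bin_top_def)
qed

lemma digit_reversal_even:
  assumes "0 < n"
  shows "digit_reversal (2 * n) = digit_reversal n"
proof -
  have "real (digit_reversal (2 * n)) = real (digit_reversal n)"
    using assms by (simp add: digit_reversal_eq_van_der_corput)
  then show ?thesis by simp
qed

lemma digit_reversal_odd:
  assumes "0 < n"
  shows "digit_reversal (Suc (2 * n)) = 2 ^ Suc (bin_top n) + digit_reversal n"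
proof -
  have "real (digit_reversal (Suc (2 * n))) = real (2 ^ Suc (bin_top n) + digit_reversal n)"
    using assms by (simp add: digit_reversal_eq_van_der_corput add_divide_distrib distrib_left)
  then show ?thesis by (simp only: of_nat_eq_iff)
qed

lemma digit_reversal_less: "digit_reversal n < 2 ^ Suc (bin_top n)"
proof -
  have "real (digit_reversal n) < real (2 ^ Suc (bin_top n))"
    using van_der_corput_bounds[of n] by (simp add: digit_reversal_eq_van_der_corput)
  then show ?thesis by (simp only: of_nat_less_iff)
qed

section \<open>Invariance under digit reversal\<close>

lemma max_excess_power [simp]: "max_excess (2 ^ k) = 1"
  by (induction k) (simp_all add: max_excess_Suc)

text \<open>A new top digit at position \<open>k\<close> raises \<omega> by
  \<open>1 / 2 ^ Suc k\<close>, so each further term loses \<open>1 / 2 ^ k\<close>.\<close>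

lemma max_excess_power_add:
  assumes "n \<le> 2 ^ k"
  shows "max_excess (2 ^ k + n) = max_excess n + 1 - real n / 2 ^ k"
  using assms
  by (induction n)
    (simp_all add: max_excess_Suc van_der_corput_power_add add_divide_distrib)

lemma max_excess_digit_reversal:
  assumes "0 < n"
  shows "max_excess (digit_reversal n) = max_excess n"
  using assms
proof (induction n rule: less_induct)
  case (less N)
  obtain n where "N = 2 * n \<or> N = Suc (2 * n)" by (metis evenE oddE Suc_eq_plus1)
  then consider "N = 1" | "N = 2 * n" "0 < n" "n < N" | "N = Suc (2 * n)" "0 < n" "n < N"
    using less.prems by (cases n) auto
  then show ?case
  proof cases
    case 1
    then show ?thesis by (simp add: digit_reversal_def bin_top_def bin_digit_def)
  next
    case 2
    then show ?thesis using less.IH by (simp add: digit_reversal_even)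
  next
    case 3
    \<comment> \<open>The new top bit sits at \<open>Suc (bin_top n)\<close> even if trailing zeros
      of \<open>n\<close> make its reversal shorter.\<close>
    have "max_excess (digit_reversal N) =
        max_excess (digit_reversal n) + 1 - real (digit_reversal n) / 2 ^ Suc (bin_top n)"
      unfolding 3(1) digit_reversal_odd[OF 3(2)]
      by (intro max_excess_power_add less_imp_le digit_reversal_less)
    also have "\<dots> = max_excess n + 1 - van_der_corput n"
      using less.IH[OF 3(3,2)] by (simp add: digit_reversal_eq_van_der_corput)
    finally show ?thesis using 3 by simp
  qed
qed

text \<open>The leading 1 of \<open>n\<close> becomes the lowest digit. Positivity allows
  \<open>discrepancy_van_der_corput\<close> to be applied to the reversal.\<close>

lemma digit_reversal_pos:
  assumes "0 < n"
  shows "0 < digit_reversal n"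
proof (rule ccontr)
  assume "\<not> 0 < digit_reversal n"
  then have "\<forall>i\<in>{0..bin_top n}. bin_digit n (bin_top n - i) = 0"
    by (simp add: digit_reversal_def)
  then have "bin_digit n (bin_top n - 0) = 0"
    by (rule bspec) simp
  then show False
    using assms bin_top_leading[of n] less_power_bin_top[of n]
    by (cases "n = 1") (auto simp: bin_digit_def)
qed

theorem corollary2p5:
  fixes N :: nat
  assumes "N \<ge> 1"
  shows "real N * discrepancy N van_der_corput =
         real (digit_reversal N) * discrepancy (digit_reversal N) van_der_corput"
  using assms
  by (simp add: discrepancy_van_der_corput digit_reversal_pos max_excess_digit_reversal Suc_le_eq)

end
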